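(* Let $(X,r)$ be an injective solution. Then the structure skew brace $G(X,r)$ is a bi-skew brace if and only if $\sigma_{\hat\sigma_x(y)}=\sigma_y$ for all $x,y\in X$.
   Context: A skew brace (meaning skew left brace) is a set $A$ with two group structures $(A,\cdot)$ (the additive group) and $(A,\circ)$ (the multiplicative group) such that $a\circ(b\cdot c)=(a\circ b)\cdot a^{-1}\cdot(a\circ c)$ for all $a,b,c\in A$, where $a^{-1}$ is the inverse of $a$ in $(A,\cdot)$; $\overline{a}$ denotes the inverse of $a$ in $(A,\circ)$. A bi-skew brace is a skew brace $(A,\cdot,\circ)$ such that $(A,\circ,\cdot)$ is also a skew brace. The gamma function of $A$ is $\gamma\colon(A,\circ)\to\operatorname{Aut}(A,\cdot)$, $\gamma(a)(b)=a^{-1}\cdot(a\circ b)$. A solution is a pair $(X,r)$ with $X$ a nonempty set and $r\colon X^2\to X^2$ a bijection with $r_1r_2r_1=r_2r_1r_2$ on $X^3$, where $r_1=r\times\mathrm{id}_X$ and $r_2=\mathrm{id}_X\times r$, that is nondegenerate: writing $r(x,y)=(\sigma_x(y),\tau_y(x))$, all maps $\sigma_x,\tau_x\colon X\to X$ are bijective. Then $(X,r^{-1})$ is also a solution, and one writes $r^{-1}(x,y)=(\hat\sigma_x(y),\hat\tau_y(x))$. A homomorphism of solutions $(X,r)\to(Y,s)$ is a map $f\colon X\to Y$ with $(f\times f)r=s(f\times f)$. Every skew brace $A$ gives a solution $(A,r_A)$ with $r_A(a,b)=\big(\gamma(a)(b),\ \overline{\gamma(a)(b)}\circ a\circ b\big)$.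 The structure group of a solution $(X,r)$ is the group $(G(X,r),\circ)=\langle X\mid x\circ y=\sigma_x(y)\circ\tau_y(x)\text{ for all }x,y\in X\rangle$; let $\iota\colon X\to G(X,r)$ be the canonical map sending each element to the corresponding generator. It is a known fact that there is a (unique) second group operation $\cdot$ on the set $G(X,r)$ such that $(G(X,r),\cdot,\circ)$ is a skew brace, $\iota(X)$ generates the group $(G(X,r),\cdot)$, and $\iota$ is a homomorphism of solutions $(X,r)\to(G(X,r),r_{G(X,r)})$. The structure skew brace $G(X,r)$ means $(G(X,r),\cdot,\circ)$ with this operation. The solution $(X,r)$ is injective if $\iota$ is injective. *)

theory Defs
  imports "HOL-Algebra.Generated_Groups"
begin

section \<open>Skew braces\<close>

text \<open>
  A skew brace is a pair of groups on one carrier: \<open>A\<close> is the additive group, written with a dot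
  on paper, and \<open>M\<close> is the multiplicative group, written with a circle.
\<close>

definition skew_brace :: "'g monoid \<Rightarrow> 'g monoid \<Rightarrow> bool" where
  "skew_brace A M \<longleftrightarrow>
     group A \<and> group M \<and> carrier A = carrier M \<and>
     (\<forall>a\<in>carrier A. \<forall>b\<in>carrier A. \<forall>c\<in>carrier A.
        a \<otimes>\<^bsub>M\<^esub> (b \<otimes>\<^bsub>A\<^esub> c) = (a \<otimes>\<^bsub>M\<^esub> b) \<otimes>\<^bsub>A\<^esub> inv\<^bsub>A\<^esub> a \<otimes>\<^bsub>A\<^esub> (a \<otimes>\<^bsub>M\<^esub> c))"

definition bi_skew_brace :: "'g monoid \<Rightarrow> 'g monoid \<Rightarrow> bool" where
  "bi_skew_brace A M \<longleftrightarrow> skew_brace A M \<and> skew_brace M A"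

definition gamma :: "'g monoid \<Rightarrow> 'g monoid \<Rightarrow> 'g \<Rightarrow> 'g \<Rightarrow> 'g" where
  "gamma A M a b = inv\<^bsub>A\<^esub> a \<otimes>\<^bsub>A\<^esub> (a \<otimes>\<^bsub>M\<^esub> b)"

definition brace_solution :: "'g monoid \<Rightarrow> 'g monoid \<Rightarrow> 'g \<times> 'g \<Rightarrow> 'g \<times> 'g" where
  "brace_solution A M = (\<lambda>(a, b).
     (gamma A M a b, inv\<^bsub>M\<^esub> (gamma A M a b) \<otimes>\<^bsub>M\<^esub> a \<otimes>\<^bsub>M\<^esub> b))"


section \<open>Solutions of the Yang--Baxter equation\<close>

definition sigma :: "('a \<times> 'a \<Rightarrow> 'a \<times> 'a) \<Rightarrow> 'a \<Rightarrow> 'a \<Rightarrow> 'a" where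
  "sigma r x y = fst (r (x, y))"

text \<open>The subscript comes first: \<open>tau r y x\<close> is the second component of \<open>r (x, y)\<close>.\<close>

definition tau :: "('a \<times> 'a \<Rightarrow> 'a \<times> 'a) \<Rightarrow> 'a \<Rightarrow> 'a \<Rightarrow> 'a" where
  "tau r y x = snd (r (x, y))"

definition braid1 :: "('a \<times> 'a \<Rightarrow> 'a \<times> 'a) \<Rightarrow> 'a \<times> 'a \<times> 'a \<Rightarrow> 'a \<times> 'a \<times> 'a" where
  "braid1 r = (\<lambda>(x, y, z). (fst (r (x, y)), snd (r (x, y)), z))"

definition braid2 :: "('a \<times> 'a \<Rightarrow> 'a \<times> 'a) \<Rightarrow> 'a \<times> 'a \<times> 'a \<Rightarrow> 'a \<times> 'a \<times> 'a" where
  "braid2 r = (\<lambda>(x, y, z). (x, r (y, z)))"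

definition solution :: "'a set \<Rightarrow> ('a \<times> 'a \<Rightarrow> 'a \<times> 'a) \<Rightarrow> bool" where
  "solution X r \<longleftrightarrow>
     X \<noteq> {} \<and>
     bij_betw r (X \<times> X) (X \<times> X) \<and>
     (\<forall>p \<in> X \<times> X \<times> X. braid1 r (braid2 r (braid1 r p)) = braid2 r (braid1 r (braid2 r p))) \<and>
     (\<forall>x\<in>X. bij_betw (sigma r x) X X \<and> bij_betw (tau r x) X X)"

definition sigma_hat :: "'a set \<Rightarrow> ('a \<times> 'a \<Rightarrow> 'a \<times> 'a) \<Rightarrow> 'a \<Rightarrow> 'a \<Rightarrow> 'a" where
  "sigma_hat X r = sigma (inv_into (X \<times> X) r)"

definition solution_hom ::
  "'a set \<Rightarrow> ('a \<times> 'a \<Rightarrow> 'a \<times> 'a) \<Rightarrow> 'b set \<Rightarrow> ('b \<times> 'b \<Rightarrow> 'b \<times> 'b) \<Rightarrow> ('a \<Rightarrow> 'b) \<Rightarrow> bool" where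
  "solution_hom X r Y s f \<longleftrightarrow>
     f \<in> X \<rightarrow> Y \<and> (\<forall>p \<in> X \<times> X. map_prod f f (r p) = s (map_prod f f p))"


section \<open>Groups given by generators and relations\<close>

text \<open>
  A word over \<open>X\<close> is a list of letters \<open>(x, e)\<close>, where \<open>e = True\<close> stands for the generator \<open>x\<close>
  and \<open>e = False\<close> for its formal inverse.
\<close>

type_synonym 'a word = "('a \<times> bool) list"

abbreviation words :: "'a set \<Rightarrow> 'a word set" where
  "words X \<equiv> lists (X \<times> UNIV)"

inductive word_cong :: "'a set \<Rightarrow> ('a word \<times> 'a word) set \<Rightarrow> 'a word \<Rightarrow> 'a word \<Rightarrow> bool"
  for X :: "'a set" and R :: "('a word \<times> 'a word) set" where
  refl: "w \<in> words X \<Longrightarrow> word_cong X R w w"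
| sym: "word_cong X R u v \<Longrightarrow> word_cong X R v u"
| trans: "word_cong X R u v \<Longrightarrow> word_cong X R v w \<Longrightarrow> word_cong X R u w"
| append: "word_cong X R u u' \<Longrightarrow> word_cong X R v v' \<Longrightarrow> word_cong X R (u @ v) (u' @ v')"
| cancel: "x \<in> X \<Longrightarrow> word_cong X R [(x, e), (x, \<not> e)] []"
| relator: "(u, v) \<in> R \<Longrightarrow> u \<in> words X \<Longrightarrow> v \<in> words X \<Longrightarrow> word_cong X R u v"

definition word_class :: "'a set \<Rightarrow> ('a word \<times> 'a word) set \<Rightarrow> 'a word \<Rightarrow> 'a word set" where
  "word_class X R u = {v. word_cong X R u v}"

definition presented_group :: "'a set \<Rightarrow> ('a word \<times> 'a word) set \<Rightarrow> 'a word set monoid" where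
  "presented_group X R =
     \<lparr>carrier = word_class X R ` words X,
      mult = (\<lambda>U V. \<Union>u\<in>U. \<Union>v\<in>V. word_class X R (u @ v)),
      one = word_class X R []\<rparr>"

lemma word_cong_words:
  assumes "word_cong X R u v"
  shows "u \<in> words X \<and> v \<in> words X"
  using assms by induction auto

lemma word_class_eq_iff:
  assumes "u \<in> words X"
  shows "word_class X R u = word_class X R v \<longleftrightarrow> word_cong X R u v"
  using assms unfolding word_class_def
  by (metis (mono_tags, lifting) Collect_cong mem_Collect_eq word_cong.refl word_cong.sym word_cong.trans)

lemma presented_group_mult:
  assumes "u \<in> words X" "v \<in> words X"
  shows "word_class X R u \<otimes>\<^bsub>presented_group X R\<^esub> word_class X R v = word_class X R (u @ v)"
  using assms unfolding presented_group_def word_class_def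
  by (auto intro: word_cong.refl word_cong.append word_cong.trans)

lemma word_cong_inverse:
  assumes "w \<in> words X"
  shows "word_cong X R (rev (map (\<lambda>(x, e). (x, \<not> e)) w) @ w) []"
  using assms
proof (induction w)
  case Nil
  then show ?case by (simp add: word_cong.refl)
next
  case (Cons a w)
  obtain x e where a: "a = (x, e)" by (cases a)
  let ?v = "rev (map (\<lambda>(x, e). (x, \<not> e)) w)"
  have x: "x \<in> X" and w: "w \<in> words X" using Cons.hyps a by auto
  have v: "?v \<in> words X" using w by (auto simp: in_lists_conv_set intro!: in_listsI dest!: in_listsD)
  have "word_cong X R [(x, \<not> e), (x, e)] []"
    using word_cong.cancel[OF x, of R "\<not> e"] by simp
  from word_cong.append[OF word_cong.refl[OF v] word_cong.append[OF this word_cong.refl[OF w]]]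
  have "word_cong X R (?v @ [(x, \<not> e), (x, e)] @ w) (?v @ w)" by simp
  with Cons.IH a show ?case by (auto intro: word_cong.trans)
qed

lemma group_presented_group: "group (presented_group X R)"
proof (rule groupI)
  note in_lists_conv_set [simp del] in_listsD [rule del] in_listsI [rule del]
  let ?G = "presented_group X R"
  have car: "carrier ?G = word_class X R ` words X" and one: "\<one>\<^bsub>?G\<^esub> = word_class X R []"
    by (simp_all add: presented_group_def)
  show "\<one>\<^bsub>?G\<^esub> \<in> carrier ?G" by (auto simp: car one)
  show "x \<otimes>\<^bsub>?G\<^esub> y \<in> carrier ?G" if "x \<in> carrier ?G" "y \<in> carrier ?G" for x y
    using that by (auto simp: car presented_group_mult)
  show "x \<otimes>\<^bsub>?G\<^esub> y \<otimes>\<^bsub>?G\<^esub> z = x \<otimes>\<^bsub>?G\<^esub> (y \<otimes>\<^bsub>?G\<^esub> z)"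
    if "x \<in> carrier ?G" "y \<in> carrier ?G" "z \<in> carrier ?G" for x y z
    using that by (auto simp: car presented_group_mult)
  show "\<one>\<^bsub>?G\<^esub> \<otimes>\<^bsub>?G\<^esub> x = x" if "x \<in> carrier ?G" for x
    using that by (auto simp: car one presented_group_mult)
  show "\<exists>y\<in>carrier ?G. y \<otimes>\<^bsub>?G\<^esub> x = \<one>\<^bsub>?G\<^esub>" if x: "x \<in> carrier ?G" for x
  proof -
    obtain w where w: "w \<in> words X" "x = word_class X R w" using x by (auto simp: car)
    let ?v = "rev (map (\<lambda>(x, e). (x, \<not> e)) w)"
    have v: "?v \<in> words X" using w by (auto simp: in_lists_conv_set intro!: in_listsI dest!: in_listsD)
    have "word_class X R ?v \<otimes>\<^bsub>?G\<^esub> x = \<one>\<^bsub>?G\<^esub>"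
      using w v word_cong_inverse[OF w(1)] word_cong_words
      by (simp add: one presented_group_mult word_class_eq_iff)
    then show ?thesis using v by (auto simp: car)
  qed
qed


section \<open>The structure skew brace of a solution\<close>

definition structure_relators :: "'a set \<Rightarrow> ('a \<times> 'a \<Rightarrow> 'a \<times> 'a) \<Rightarrow> ('a word \<times> 'a word) set" where
  "structure_relators X r =
     {([(x, True), (y, True)], [(sigma r x y, True), (tau r y x, True)]) | x y. x \<in> X \<and> y \<in> X}"

definition structure_group :: "'a set \<Rightarrow> ('a \<times> 'a \<Rightarrow> 'a \<times> 'a) \<Rightarrow> 'a word set monoid" where
  "structure_group X r = presented_group X (structure_relators X r)"

definition iota :: "'a set \<Rightarrow> ('a \<times> 'a \<Rightarrow> 'a \<times> 'a) \<Rightarrow> 'a \<Rightarrow> 'a word set" where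
  "iota X r x = word_class X (structure_relators X r) [(x, True)]"

definition injective_solution :: "'a set \<Rightarrow> ('a \<times> 'a \<Rightarrow> 'a \<times> 'a) \<Rightarrow> bool" where
  "injective_solution X r \<longleftrightarrow> solution X r \<and> inj_on (iota X r) X"

text \<open>
  \<open>structure_addition X r A\<close> says that \<open>A\<close> is the additive group of the structure skew brace, whose
  multiplicative group is \<open>structure_group X r\<close>. For a solution, these three properties hold for
  exactly one group operation on the carrier of the structure group (a known theorem, not
  proved here).
\<close>

definition structure_addition ::
  "'a set \<Rightarrow> ('a \<times> 'a \<Rightarrow> 'a \<times> 'a) \<Rightarrow> 'a word set monoid \<Rightarrow> bool" where
  "structure_addition X r A \<longleftrightarrow>
     skew_brace A (structure_group X r) \<and>
     generate A (iota X r ` X) = carrier A \<and>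
     solution_hom X r (carrier (structure_group X r)) (brace_solution A (structure_group X r))
       (iota X r)"

end

theory Submission imports Defs begin

text \<open>
  Write \<open>\<cdot>\<close> for the additive operation (group \<open>A\<close>), \<open>\<odot>\<close> for the multiplicative one (group \<open>M\<close>),
  and \<open>\<gamma>\<close> for the gamma function, a homomorphism from \<open>M\<close> to the automorphisms of \<open>A\<close>.

  A skew brace is bi-skew exactly when \<open>\<gamma>\<close> reverses the other product as well:
  \<open>\<gamma>(a \<cdot> b) = \<gamma>(b) \<gamma>(a)\<close> (lemma \<open>bi_skew_iff_gamma_antihom\<close>). On the other hand, if
  \<open>r(z, w) = (x, y)\<close>, that is, \<open>z\<close> is the hat-sigma image of \<open>y\<close> under \<open>x\<close>, then the images of
  these elements in the structure skew brace satisfy \<open>z \<cdot> x = x \<odot> y\<close> (lemma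
  \<open>iota_add_eq_mult\<close>). So \<open>\<gamma>(z \<cdot> x) = \<gamma>(x) \<gamma>(y)\<close>, and \<open>\<gamma>\<close> reverses the product \<open>z \<cdot> x\<close> if and
  only if \<open>\<gamma>(z) = \<gamma>(y)\<close>. Since the solution embeds in the structure skew brace and generates
  its additive group, \<open>\<gamma>(z) = \<gamma>(y)\<close> means that \<open>z\<close> and \<open>y\<close> have the same sigma map. This gives
  the direction from bi-skew to the identity on sigma.

  Conversely, the identity on sigma says that \<open>\<gamma>\<close> reverses \<open>z \<cdot> x\<close> for generators \<open>z\<close> and \<open>x\<close>,
  and this has to be extended to all elements. To replace the right factor \<open>x\<close> by an arbitrary
  \<open>a\<close>, one builds \<open>a\<close> as a word in the multiplicative group and carries along the statement that
  every generator \<open>z\<close> satisfies \<open>z \<cdot> a = a \<odot> y\<close> for some generator \<open>y\<close> with \<open>\<gamma>(y) = \<gamma>(z)\<close>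
  (lemma \<open>iota_passes_through\<close>). The left factors for which \<open>\<gamma>\<close> reverses all products form a
  subgroup of the additive group (lemma \<open>gamma_antihom_generate\<close>), which then contains
  everything.
\<close>

section \<open>The gamma function of a skew brace\<close>

locale skew_brace_pair =
  fixes A M :: "'g monoid"
  assumes skew_brace: "skew_brace A M"
begin

sublocale add: group A
  using skew_brace by (simp add: skew_brace_def)

sublocale mult: group M
  using skew_brace by (simp add: skew_brace_def)

abbreviation G where "G \<equiv> carrier A"
abbreviation add_op (infixl "\<cdot>" 70) where "a \<cdot> b \<equiv> a \<otimes>\<^bsub>A\<^esub> b"
abbreviation mult_op (infixl "\<odot>" 70) where "a \<odot> b \<equiv> a \<otimes>\<^bsub>M\<^esub> b"
abbreviation gam ("\<gamma>") where "\<gamma> \<equiv> gamma A M"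

lemma carrier_M: "carrier M = G"
  using skew_brace by (simp add: skew_brace_def)

lemma mult_closed [simp]: "a \<in> G \<Longrightarrow> b \<in> G \<Longrightarrow> a \<odot> b \<in> G"
  using mult.m_closed carrier_M by simp

lemma mult_inv_closed [simp]: "a \<in> G \<Longrightarrow> inv\<^bsub>M\<^esub> a \<in> G"
  using mult.inv_closed carrier_M by simp

lemma mult_one_closed [simp]: "\<one>\<^bsub>M\<^esub> \<in> G"
  using mult.one_closed carrier_M by simp

lemma mult_distrib:
  "a \<in> G \<Longrightarrow> b \<in> G \<Longrightarrow> c \<in> G \<Longrightarrow> a \<odot> (b \<cdot> c) = (a \<odot> b) \<cdot> inv\<^bsub>A\<^esub> a \<cdot> (a \<odot> c)"
  using skew_brace by (simp add: skew_brace_def)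

lemma gamma_closed [simp]: "a \<in> G \<Longrightarrow> b \<in> G \<Longrightarrow> \<gamma> a b \<in> G"
  by (simp add: gamma_def)

lemma mult_eq_add_gamma: "a \<in> G \<Longrightarrow> b \<in> G \<Longrightarrow> a \<odot> b = a \<cdot> \<gamma> a b"
  by (simp add: gamma_def add.m_assoc [symmetric])

lemma gamma_add:
  "a \<in> G \<Longrightarrow> b \<in> G \<Longrightarrow> c \<in> G \<Longrightarrow> \<gamma> a (b \<cdot> c) = \<gamma> a b \<cdot> \<gamma> a c"
  by (simp add: gamma_def mult_distrib add.m_assoc)

lemma gamma_add_inv:
  assumes "a \<in> G" "b \<in> G" shows "\<gamma> a (inv\<^bsub>A\<^esub> b) = inv\<^bsub>A\<^esub> (\<gamma> a b)"
proof -
  have "\<gamma> a \<in> hom A A"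
    using assms gamma_add by (auto simp: hom_def)
  then interpret group_hom A A "\<gamma> a"
    by unfold_locales
  show ?thesis using assms by simp
qed

lemma gamma_mult:
  assumes "a \<in> G" "b \<in> G" "c \<in> G"
  shows "\<gamma> (a \<odot> b) c = \<gamma> a (\<gamma> b c)"
proof -
  have "a \<cdot> \<gamma> a b \<cdot> \<gamma> (a \<odot> b) c = (a \<odot> b) \<odot> c"
    using assms mult_eq_add_gamma [of "a \<odot> b" c] mult_eq_add_gamma [of a b] by simp
  also have "\<dots> = a \<odot> (b \<cdot> \<gamma> b c)"
    using assms mult.m_assoc mult_eq_add_gamma [of b c] by (simp add: carrier_M)
  also have "\<dots> = a \<cdot> \<gamma> a b \<cdot> \<gamma> a (\<gamma> b c)"
    using assms by (simp add: mult_eq_add_gamma [of a] gamma_add add.m_assoc)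
  finally show ?thesis
    using assms by simp
qed

text \<open>Expand \<open>\<one>\<^bsub>M\<^esub> \<odot> (\<one>\<^bsub>A\<^esub> \<cdot> \<one>\<^bsub>A\<^esub>)\<close> by the compatibility axiom.\<close>

lemma one_M_eq_one_A: "\<one>\<^bsub>M\<^esub> = \<one>\<^bsub>A\<^esub>"
proof -
  have "\<one>\<^bsub>M\<^esub> \<odot> (\<one>\<^bsub>A\<^esub> \<cdot> \<one>\<^bsub>A\<^esub>) = \<one>\<^bsub>A\<^esub> \<cdot> inv\<^bsub>A\<^esub> \<one>\<^bsub>M\<^esub> \<cdot> \<one>\<^bsub>A\<^esub>"
    using mult_distrib [of "\<one>\<^bsub>M\<^esub>" "\<one>\<^bsub>A\<^esub>" "\<one>\<^bsub>A\<^esub>"] mult.l_one carrier_M by simp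
  then have "inv\<^bsub>A\<^esub> \<one>\<^bsub>M\<^esub> = \<one>\<^bsub>A\<^esub>"
    using mult.l_one carrier_M by simp
  then show ?thesis by (metis add.inv_inv add.inv_one mult_one_closed)
qed

lemma one_A_mult: "a \<in> G \<Longrightarrow> \<one>\<^bsub>A\<^esub> \<odot> a = a"
  using mult.l_one [of a] by (simp add: carrier_M one_M_eq_one_A)

lemma gamma_one: "c \<in> G \<Longrightarrow> \<gamma> \<one>\<^bsub>A\<^esub> c = c"
  by (simp add: gamma_def one_A_mult)

lemma gamma_mult_inv:
  assumes "a \<in> G" "c \<in> G"
  shows "\<gamma> (inv\<^bsub>M\<^esub> a) (\<gamma> a c) = c" "\<gamma> a (\<gamma> (inv\<^bsub>M\<^esub> a) c) = c"
  using assms gamma_mult [of "inv\<^bsub>M\<^esub> a" a c] gamma_mult [of a "inv\<^bsub>M\<^esub> a" c]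
  by (simp_all add: carrier_M one_M_eq_one_A gamma_one)

lemma gamma_cancel: "a \<in> G \<Longrightarrow> b \<in> G \<Longrightarrow> c \<in> G \<Longrightarrow> \<gamma> a b = \<gamma> a c \<longleftrightarrow> b = c"
  by (metis gamma_mult_inv(1))

text \<open>The maps \<open>\<gamma> a\<close> are endomorphisms of the additive group, so a generating set determines them.\<close>

lemma gamma_eq_on_generate:
  assumes "S \<subseteq> G" "a \<in> G" "b \<in> G" and eq: "\<And>s. s \<in> S \<Longrightarrow> \<gamma> a s = \<gamma> b s"
    and "c \<in> generate A S"
  shows "\<gamma> a c = \<gamma> b c"
  using assms(5)
proof induction
  case one
  show ?case
    using gamma_add_inv assms(2,3)
    by (metis add.inv_closed add.one_closed add.r_inv gamma_add gamma_closed)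
next
  case (incl h)
  then show ?case by (rule eq)
next
  case (inv h)
  then show ?case using assms eq by (auto simp: gamma_add_inv)
next
  case (eng h1 h2)
  then show ?case
    using assms add.generate_in_carrier [OF assms(1)] by (simp add: gamma_add)
qed


section \<open>Bi-skew braces and products reversed by gamma\<close>

definition gamma_reverses :: "'g \<Rightarrow> 'g \<Rightarrow> bool" where
  "gamma_reverses a b \<longleftrightarrow> (\<forall>c\<in>G. \<gamma> (a \<cdot> b) c = \<gamma> b (\<gamma> a c))"

text \<open>
  With the two operations exchanged, the right-hand side of the compatibility axiom,
  \<open>(a \<cdot> b) \<odot> a' \<odot> (a \<cdot> c)\<close> with \<open>a'\<close> the inverse of \<open>a\<close> in \<open>M\<close>, equals
  \<open>a \<cdot> b \<cdot> \<gamma>(a \<cdot> b)(\<gamma>(a)\<inverse>(c))\<close>, because \<open>a \<cdot> c = a \<odot> \<gamma>(a)\<inverse>(c)\<close>. The left-hand side is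
  \<open>a \<cdot> b \<cdot> \<gamma>(b)(c)\<close>. Thus the axiom says \<open>\<gamma>(a \<cdot> b) \<gamma>(a)\<inverse> = \<gamma>(b)\<close>.
\<close>

lemma bi_skew_iff_gamma_antihom:
  "bi_skew_brace A M \<longleftrightarrow> (\<forall>a\<in>G. \<forall>b\<in>G. gamma_reverses a b)"
proof -
  have axiom_iff: "a \<cdot> (b \<odot> c) = (a \<cdot> b) \<odot> inv\<^bsub>M\<^esub> a \<odot> (a \<cdot> c)
      \<longleftrightarrow> \<gamma> (a \<cdot> b) (\<gamma> (inv\<^bsub>M\<^esub> a) c) = \<gamma> b c"
    if "a \<in> G" "b \<in> G" "c \<in> G" for a b c
  proof -
    have "a \<cdot> c = a \<odot> \<gamma> (inv\<^bsub>M\<^esub> a) c"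
      using that by (simp add: mult_eq_add_gamma gamma_mult_inv)
    then have "inv\<^bsub>M\<^esub> a \<odot> (a \<cdot> c) = \<gamma> (inv\<^bsub>M\<^esub> a) c"
      using that by (simp add: carrier_M mult.m_assoc [symmetric])
    moreover have "(a \<cdot> b) \<odot> inv\<^bsub>M\<^esub> a \<odot> (a \<cdot> c) = (a \<cdot> b) \<odot> (inv\<^bsub>M\<^esub> a \<odot> (a \<cdot> c))"
      using that mult.m_assoc by (simp add: carrier_M)
    ultimately have "(a \<cdot> b) \<odot> inv\<^bsub>M\<^esub> a \<odot> (a \<cdot> c) = a \<cdot> b \<cdot> \<gamma> (a \<cdot> b) (\<gamma> (inv\<^bsub>M\<^esub> a) c)"
      using that by (simp add: mult_eq_add_gamma [of "a \<cdot> b"])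
    moreover have "a \<cdot> (b \<odot> c) = a \<cdot> b \<cdot> \<gamma> b c"
      using that by (simp add: mult_eq_add_gamma add.m_assoc)
    ultimately show ?thesis
      using that by auto
  qed
  have "gamma_reverses a b \<longleftrightarrow> (\<forall>c\<in>G. \<gamma> (a \<cdot> b) (\<gamma> (inv\<^bsub>M\<^esub> a) c) = \<gamma> b c)"
    if "a \<in> G" "b \<in> G" for a b
  proof
    assume "gamma_reverses a b"
    then show "\<forall>c\<in>G. \<gamma> (a \<cdot> b) (\<gamma> (inv\<^bsub>M\<^esub> a) c) = \<gamma> b c"
      using that by (simp add: gamma_reverses_def gamma_mult_inv)
  next
    assume eq: "\<forall>c\<in>G. \<gamma> (a \<cdot> b) (\<gamma> (inv\<^bsub>M\<^esub> a) c) = \<gamma> b c"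
    have "\<gamma> (a \<cdot> b) c = \<gamma> b (\<gamma> a c)" if "c \<in> G" for c
      using bspec [OF eq, of "\<gamma> a c"] \<open>a \<in> G\<close> that by (simp add: gamma_mult_inv)
    then show "gamma_reverses a b" by (simp add: gamma_reverses_def)
  qed
  moreover have "bi_skew_brace A M \<longleftrightarrow> (\<forall>a\<in>G. \<forall>b\<in>G. \<forall>c\<in>G.
      a \<cdot> (b \<odot> c) = (a \<cdot> b) \<odot> inv\<^bsub>M\<^esub> a \<odot> (a \<cdot> c))"
    using skew_brace mult.is_group add.is_group
    by (simp add: bi_skew_brace_def skew_brace_def [of M A] carrier_M)
  ultimately show ?thesis
    by (simp add: axiom_iff)
qed

text \<open>
  The condition on a left factor quantifies over all right factors \<open>a\<close>. This makes it stable under products and, by applying it to \<open>h\<inverse> \<cdot> a\<close> and cancelling, under additive inverses.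
\<close>

lemma gamma_antihom_generate:
  assumes "S \<subseteq> G" and S: "\<And>s a. s \<in> S \<Longrightarrow> a \<in> G \<Longrightarrow> gamma_reverses s a"
    and "z \<in> generate A S" "a \<in> G"
  shows "gamma_reverses z a"
  using assms(3,4)
proof (induction arbitrary: a)
  case one
  then show ?case by (simp add: gamma_reverses_def gamma_one)
next
  case (incl h)
  then show ?case by (simp add: S)
next
  case (inv h)
  have h: "h \<in> G" using inv.hyps assms(1) by blast
  have key: "\<gamma> b c = \<gamma> (inv\<^bsub>A\<^esub> h \<cdot> b) (\<gamma> h c)" if "b \<in> G" "c \<in> G" for b c
    using S [OF inv.hyps, of "inv\<^bsub>A\<^esub> h \<cdot> b"] that h
    by (simp add: gamma_reverses_def add.m_assoc [symmetric])
  \<comment> \<open>Taking \<open>b = \<one>\<close> shows that \<open>\<gamma>\<close> sends the additive inverse of \<open>h\<close> to the inverse map of \<open>\<gamma> h\<close>.\<close>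
  have "\<gamma> h (\<gamma> (inv\<^bsub>A\<^esub> h) c) = c" if "c \<in> G" for c
  proof -
    have "\<gamma> (inv\<^bsub>A\<^esub> h) c = \<gamma> (inv\<^bsub>M\<^esub> h) c"
      using key [of "\<one>\<^bsub>A\<^esub>" "\<gamma> (inv\<^bsub>M\<^esub> h) c"] that h by (simp add: gamma_one gamma_mult_inv)
    then show ?thesis using that h by (simp add: gamma_mult_inv)
  qed
  then show ?case
    using key [OF inv.prems] h by (simp add: gamma_reverses_def)
next
  case (eng h1 h2)
  then have "h1 \<in> G" "h2 \<in> G"
    using add.generate_in_carrier [OF assms(1)] by auto
  with eng show ?case
    by (simp add: gamma_reverses_def add.m_assoc)
qed

end


section \<open>Generators in the structure skew brace\<close>

text \<open>
  Elements of the multiplicative group are classes of words, so they can be built by prepending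
  one letter, a generator or the inverse of one, at a time.
\<close>

lemma structure_group_induct [consumes 1, case_names one gen inv]:
  fixes X :: "'a set" and r :: "'a \<times> 'a \<Rightarrow> 'a \<times> 'a"
  defines "M \<equiv> structure_group X r"
  assumes "a \<in> carrier M" and one: "P \<one>\<^bsub>M\<^esub>"
    and gen: "\<And>x a. x \<in> X \<Longrightarrow> a \<in> carrier M \<Longrightarrow> P a \<Longrightarrow> P (iota X r x \<otimes>\<^bsub>M\<^esub> a)"
    and inv: "\<And>x a. x \<in> X \<Longrightarrow> a \<in> carrier M \<Longrightarrow> P a \<Longrightarrow> P (inv\<^bsub>M\<^esub> (iota X r x) \<otimes>\<^bsub>M\<^esub> a)"
  shows "P a"
proof -
  let ?c = "word_class X (structure_relators X r)"
  interpret M: group M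
    unfolding M_def structure_group_def by (rule group_presented_group)
  have carrier: "?c w \<in> carrier M" if "w \<in> words X" for w
    using that by (simp add: M_def structure_group_def presented_group_def)
  have mult: "?c u \<otimes>\<^bsub>M\<^esub> ?c v = ?c (u @ v)" if "u \<in> words X" "v \<in> words X" for u v
    using that by (simp add: M_def structure_group_def presented_group_mult)
  have nil: "?c [] = \<one>\<^bsub>M\<^esub>"
    by (simp add: M_def structure_group_def presented_group_def)
  have inverse: "?c [(x, False)] = inv\<^bsub>M\<^esub> (iota X r x)" if "x \<in> X" for x
  proof (rule M.inv_equality [symmetric])
    have "word_cong X (structure_relators X r) [(x, False), (x, True)] []"
      using word_cong.cancel [OF that, of _ False] by simp
    then show "?c [(x, False)] \<otimes>\<^bsub>M\<^esub> iota X r x = \<one>\<^bsub>M\<^esub>"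
      using that by (simp add: iota_def mult word_class_eq_iff flip: nil)
  qed (use that carrier in \<open>simp_all add: iota_def\<close>)
  obtain w where w: "w \<in> words X" "a = ?c w"
    using assms(2) by (auto simp: M_def structure_group_def presented_group_def)
  from w(1) have "P (?c w)"
  proof (induction w)
    case Nil
    then show ?case using one by (simp add: nil)
  next
    case (Cons l w)
    obtain x e where l: "l = (x, e)" and x: "x \<in> X" using Cons.hyps by (cases l) auto
    have "?c (l # w) = ?c [l] \<otimes>\<^bsub>M\<^esub> ?c w"
      using mult [of "[l]" w] Cons.hyps by simp
    also have "?c [l] = (if e then iota X r x else inv\<^bsub>M\<^esub> (iota X r x))"
      using x inverse by (simp add: l iota_def)
    finally show ?case
      using gen [OF x carrier Cons.IH] inv [OF x carrier Cons.IH] Cons.hyps by (cases e) auto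
  qed
  then show ?thesis using w by simp
qed

text \<open>
  The multiplicative group is a parameter \<open>M\<close> with a defining equation, so that the notation of
  \<open>skew_brace_pair\<close> applies to it.
\<close>

locale structure_skew_brace = skew_brace_pair A M
  for A M :: "'a word set monoid" +
  fixes X :: "'a set" and r :: "'a \<times> 'a \<Rightarrow> 'a \<times> 'a"
  assumes M_eq: "M = structure_group X r"
    and injective: "injective_solution X r"
    and addition: "structure_addition X r A"
begin

abbreviation i where "i \<equiv> iota X r"

lemma generate_iota: "generate A (i ` X) = G"
  using addition by (simp add: structure_addition_def)

lemma iota_hom: "solution_hom X r G (brace_solution A M) i"
  using addition carrier_M by (simp add: structure_addition_def M_eq)

lemma iota_closed [simp]: "x \<in> X \<Longrightarrow> i x \<in> G"
  using iota_hom by (auto simp: solution_hom_def)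

lemma r_closed: "z \<in> X \<Longrightarrow> w \<in> X \<Longrightarrow> r (z, w) \<in> X \<times> X"
  using injective by (auto simp: injective_solution_def solution_def dest: bij_betwE)

lemma gamma_iota:
  assumes "x \<in> X" "y \<in> X" shows "\<gamma> (i x) (i y) = i (sigma r x y)"
proof -
  have "map_prod i i (r (x, y)) = brace_solution A M (i x, i y)"
    using iota_hom assms by (auto simp: solution_hom_def)
  then show ?thesis
    by (cases "r (x, y)") (simp add: brace_solution_def sigma_def)
qed

text \<open>
  Injectivity of the solution is what lets the sigma map be recovered from the gamma function;
  generation gives the other direction.
\<close>

lemma gamma_iota_eq_iff:
  assumes "x \<in> X" "y \<in> X"
  shows "(\<forall>c\<in>G. \<gamma> (i x) c = \<gamma> (i y) c) \<longleftrightarrow> (\<forall>z\<in>X. sigma r x z = sigma r y z)"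
proof
  assume eq: "\<forall>c\<in>G. \<gamma> (i x) c = \<gamma> (i y) c"
  show "\<forall>z\<in>X. sigma r x z = sigma r y z"
  proof
    fix z assume z: "z \<in> X"
    have "i (sigma r x z) = i (sigma r y z)"
      using eq z assms by (simp flip: gamma_iota)
    moreover have "sigma r x z \<in> X" "sigma r y z \<in> X"
      using r_closed assms z by (auto simp: sigma_def mem_Times_iff)
    ultimately show "sigma r x z = sigma r y z"
      using injective by (auto simp: injective_solution_def dest: inj_onD)
  qed
next
  assume eq: "\<forall>z\<in>X. sigma r x z = sigma r y z"
  have "\<gamma> (i x) c = \<gamma> (i y) c" if "c \<in> generate A (i ` X)" for c
    by (rule gamma_eq_on_generate [OF _ _ _ _ that]) (use assms eq in \<open>auto simp: gamma_iota\<close>)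
  then show "\<forall>c\<in>G. \<gamma> (i x) c = \<gamma> (i y) c"
    by (simp add: generate_iota)
qed

text \<open>
  Both sides are \<open>z \<odot> w\<close>: the left-hand one because \<open>x = \<gamma>(z)(w)\<close>, the right-hand one because
  the solution of a skew brace preserves the product of a pair in \<open>M\<close>.
\<close>

lemma iota_add_eq_mult:
  assumes "z \<in> X" "w \<in> X" "r (z, w) = (x, y)"
  shows "i z \<cdot> i x = i x \<odot> i y"
proof -
  have xy: "x \<in> X" "y \<in> X" using r_closed [OF assms(1,2)] assms(3) by auto
  have "map_prod i i (r (z, w)) = brace_solution A M (i z, i w)"
    using iota_hom assms(1,2) by (simp add: solution_hom_def)
  then have x: "i x = \<gamma> (i z) (i w)" and y: "i y = inv\<^bsub>M\<^esub> (i x) \<odot> i z \<odot> i w"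
    using assms(3) by (simp_all add: brace_solution_def)
  have M: "i x \<in> carrier M" "i z \<in> carrier M" "i w \<in> carrier M"
    using xy assms by (simp_all add: carrier_M)
  have "i x \<odot> i y = i x \<odot> inv\<^bsub>M\<^esub> (i x) \<odot> i z \<odot> i w"
    unfolding y using M by (simp only: mult.m_assoc mult.m_closed mult.inv_closed)
  also have "\<dots> = i z \<odot> i w"
    using M by simp
  also have "\<dots> = i z \<cdot> i x"
    using assms(1,2) by (simp add: mult_eq_add_gamma x)
  finally show ?thesis ..
qed

lemma sigma_hat_preimage:
  assumes "x \<in> X" "y \<in> X"
  obtains w where "sigma_hat X r x y \<in> X" "w \<in> X" "r (sigma_hat X r x y, w) = (x, y)"
proof -
  have bij: "bij_betw r (X \<times> X) (X \<times> X)"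
    using injective by (simp add: injective_solution_def solution_def)
  obtain z w where zw: "inv_into (X \<times> X) r (x, y) = (z, w)" by fastforce
  have "(x, y) \<in> r ` (X \<times> X)"
    using bij assms by (simp add: bij_betw_def)
  then have "(z, w) \<in> X \<times> X" "r (z, w) = (x, y)"
    using inv_into_into [of "(x, y)" r "X \<times> X"] f_inv_into_f [of "(x, y)" r "X \<times> X"] zw by auto
  moreover have "sigma_hat X r x y = z"
    by (simp add: sigma_hat_def sigma_def zw)
  ultimately show thesis using that by auto
qed

text \<open>
  Surjectivity of a hat-sigma map follows from surjectivity of a sigma map: choose \<open>w\<close> with
  \<open>sigma r z w = x\<close>, so that \<open>r (z, w)\<close> has first component \<open>x\<close>.
\<close>

lemma sigma_hat_surj:
  assumes "x \<in> X" "z \<in> X"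
  obtains w y where "w \<in> X" "y \<in> X" "r (z, w) = (x, y)" "sigma_hat X r x y = z"
proof -
  have bij: "bij_betw r (X \<times> X) (X \<times> X)" and "bij_betw (sigma r z) X X"
    using injective assms by (simp_all add: injective_solution_def solution_def)
  then obtain w where w: "w \<in> X" "sigma r z w = x"
    using assms by (metis bij_betw_imp_surj_on imageE)
  define y where "y = snd (r (z, w))"
  have r: "r (z, w) = (x, y)"
    using w by (auto simp: y_def sigma_def)
  moreover have "y \<in> X"
    using r_closed [OF assms(2) w(1)] r by simp
  moreover have "sigma_hat X r x y = z"
    using inv_into_f_f [OF bij_betw_imp_inj_on [OF bij], of "(z, w)"] assms w r
    by (simp add: sigma_hat_def sigma_def)
  ultimately show thesis using that w by blast
qed

text \<open>
  The element \<open>y\<close> is the image of \<open>z\<close> under the inverse of the automorphism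
  \<open>y \<mapsto> (a \<odot> y) \<cdot> a\<inverse>\<close> of the additive group, which extends the hat-sigma maps. This
  automorphism depends multiplicatively on \<open>a\<close>, so it suffices to control it when \<open>a\<close> is a
  generator or the inverse of one.
\<close>

lemma iota_passes_through:
  assumes sig: "\<forall>x\<in>X. \<forall>y\<in>X. \<forall>z\<in>X. sigma r (sigma_hat X r x y) z = sigma r y z"
    and "a \<in> G" "z \<in> X"
  shows "\<exists>y\<in>X. i z \<cdot> a = a \<odot> i y \<and> (\<forall>c\<in>G. \<gamma> (i y) c = \<gamma> (i z) c)"
proof -
  have "a \<in> carrier M" using assms(2) carrier_M by simp
  then show ?thesis using assms(3)
  proof (induction a arbitrary: z rule:
    structure_group_induct [where X = X and r = r, folded M_eq, consumes 1, case_names one gen inv])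
    case one
    then show ?case
      using one_A_mult [of "i z"] by (auto simp: one_M_eq_one_A)
  next
    case (gen x a)
    have a: "a \<in> G" using gen carrier_M by simp
    obtain w y where y: "w \<in> X" "y \<in> X" "r (z, w) = (x, y)" "sigma_hat X r x y = z"
      using sigma_hat_surj gen by blast
    obtain y' where y': "y' \<in> X" "i y \<cdot> a = a \<odot> i y'" "\<forall>c\<in>G. \<gamma> (i y') c = \<gamma> (i y) c"
      using gen.IH [OF y(2)] by blast
    have "\<forall>c\<in>G. \<gamma> (i z) c = \<gamma> (i y) c"
      using gamma_iota_eq_iff [of z y] sig y gen by auto
    moreover have "i z \<cdot> (i x \<odot> a) = (i x \<odot> a) \<odot> i y'"
    proof -
      have "(i x \<odot> a) \<odot> i y' = i x \<odot> (i y \<cdot> a)"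
        using gen y' a mult.m_assoc by (simp add: carrier_M)
      also have "\<dots> = i z \<cdot> i x \<cdot> inv\<^bsub>A\<^esub> (i x) \<cdot> (i x \<odot> a)"
        using gen y a iota_add_eq_mult [OF _ y(1,3)] by (simp add: mult_distrib)
      finally show ?thesis
        using gen a by (simp add: add.m_assoc)
    qed
    ultimately show ?case using y' by auto
  next
    case (inv x a)
    let ?b = "inv\<^bsub>M\<^esub> (i x) \<odot> a"
    have a: "a \<in> G" using inv carrier_M by simp
    define y where "y = sigma_hat X r x z"
    obtain w where y: "y \<in> X" "w \<in> X" "r (y, w) = (x, z)"
      using sigma_hat_preimage inv unfolding y_def by metis
    obtain y' where y': "y' \<in> X" "i y \<cdot> a = a \<odot> i y'" "\<forall>c\<in>G. \<gamma> (i y') c = \<gamma> (i y) c"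
      using inv.IH [OF y(1)] by blast
    have "\<forall>c\<in>G. \<gamma> (i y) c = \<gamma> (i z) c"
      using gamma_iota_eq_iff [of y z] sig y inv by (auto simp: y_def)
    moreover have "i z \<cdot> ?b = ?b \<odot> i y'"
    proof -
      have xb: "i x \<odot> ?b = a"
        using inv a by (simp add: carrier_M mult.m_assoc [symmetric])
      have "i x \<odot> (i z \<cdot> ?b) = i y \<cdot> i x \<cdot> inv\<^bsub>A\<^esub> (i x) \<cdot> a"
        using inv a xb iota_add_eq_mult [OF y] by (simp add: mult_distrib)
      also have "\<dots> = a \<odot> i y'"
        using inv a y y' by (simp add: add.m_assoc)
      also have "\<dots> = i x \<odot> (?b \<odot> i y')"
        using inv a y' xb mult.m_assoc [of "i x" ?b "i y'"] by (simp add: carrier_M)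
      finally show ?thesis
        using inv a y' by (simp add: carrier_M)
    qed
    ultimately show ?case using y' by auto
  qed
qed


section \<open>The criterion\<close>

theorem bi_skew_iff_sigma_hat:
  "bi_skew_brace A M \<longleftrightarrow>
    (\<forall>x\<in>X. \<forall>y\<in>X. \<forall>z\<in>X. sigma r (sigma_hat X r x y) z = sigma r y z)"
proof
  assume bi: "bi_skew_brace A M"
  show "\<forall>x\<in>X. \<forall>y\<in>X. \<forall>z\<in>X. sigma r (sigma_hat X r x y) z = sigma r y z"
  proof (intro ballI)
    fix x y u assume X: "x \<in> X" "y \<in> X" "u \<in> X"
    define z where "z = sigma_hat X r x y"
    obtain w where z: "z \<in> X" "w \<in> X" "r (z, w) = (x, y)"
      using sigma_hat_preimage X unfolding z_def by metis
    have "\<gamma> (i z) c = \<gamma> (i y) c" if c: "c \<in> G" for c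
    proof -
      have "\<gamma> (i x) (\<gamma> (i z) c) = \<gamma> (i z \<cdot> i x) c"
        using bi c X z by (simp add: bi_skew_iff_gamma_antihom gamma_reverses_def)
      also have "\<dots> = \<gamma> (i x) (\<gamma> (i y) c)"
        using c X by (simp add: iota_add_eq_mult [OF z] gamma_mult)
      finally show ?thesis
        using c X z by (simp add: gamma_cancel)
    qed
    then show "sigma r (sigma_hat X r x y) u = sigma r y u"
      using gamma_iota_eq_iff [of z y] X z by (simp add: z_def)
  qed
next
  assume sig: "\<forall>x\<in>X. \<forall>y\<in>X. \<forall>z\<in>X. sigma r (sigma_hat X r x y) z = sigma r y z"
  have gens: "gamma_reverses s a" if s: "s \<in> i ` X" and a: "a \<in> G" for s a
  proof -
    obtain z where z: "z \<in> X" "s = i z" using s by blast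
    obtain y where "y \<in> X" "i z \<cdot> a = a \<odot> i y" "\<forall>c\<in>G. \<gamma> (i y) c = \<gamma> (i z) c"
      using iota_passes_through [OF sig a z(1)] by blast
    then show ?thesis
      using z a by (simp add: gamma_reverses_def gamma_mult)
  qed
  have "gamma_reverses a b" if "a \<in> G" "b \<in> G" for a b
    using gamma_antihom_generate [where S = "i ` X" and z = a and a = b] that gens
    by (simp add: generate_iota image_subset_iff)
  then show "bi_skew_brace A M"
    by (simp add: bi_skew_iff_gamma_antihom)
qed

end

theorem theorem5p4:
  fixes X :: "'a set" and r :: "'a \<times> 'a \<Rightarrow> 'a \<times> 'a" and A :: "'a word set monoid"
  assumes "injective_solution X r"
    and "structure_addition X r A"
  shows "bi_skew_brace A (structure_group X r) \<longleftrightarrow>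
    (\<forall>x\<in>X. \<forall>y\<in>X. \<forall>z\<in>X. sigma r (sigma_hat X r x y) z = sigma r y z)"
proof -
  interpret structure_skew_brace A "structure_group X r" X r
    using assms by unfold_locales (simp_all add: structure_addition_def)
  show ?thesis by (rule bi_skew_iff_sigma_hat)
qed

end
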